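(* Let $n,m$ be positive integers with $m\le\lfloor n/2\rfloor$, let $\boldsymbol{x}=\{x_1,\dots,x_n\}$ be distinct points of the real line and let $\boldsymbol{\xi}=\{\xi_1,\dots,\xi_m\}$ be distinct points of $\mathbb{C}\setminus\{x_1,\dots,x_n\}$. The following are equivalent: (1) The set $\boldsymbol{\xi}$ is closed under complex conjugation and $\boldsymbol{x},\boldsymbol{\xi}$ satisfy the stationary relations $$-\sum_{j=1}^{n}\frac{1}{\xi_k-x_j}+\sum_{l\neq k}\frac{2}{\xi_k-\xi_l}=0,\qquad k=1,\dots,m .$$ (2) There exists $R\in\mathcal{CR}_{m,n}(\boldsymbol{x})$ having $\boldsymbol{\xi}$ as its finite poles and $\boldsymbol{x}$ as its finite critical points.
   Context: For distinct real points $\boldsymbol{x}=\{x_1,\dots,x_n\}$, $\mathcal{CR}_{m,n}(\boldsymbol{x})$ denotes the class of rational functions $R(z)$ such that: (a) $R$ is real, i.e. $\overline{R(\bar z)}=R(z)$; (b) the finite critical points of $R$ (the zeros of $R'$ in $\mathbb{C}$) are exactly $x_1,\dots,x_n$, and they are simple; (c) the finite poles of $R$ are $m$ distinct simple poles; (d) $R$ has a pole of order $n-2m+1$ at $\infty$. *)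

theory Defs
  imports "HOL-Complex_Analysis.Complex_Analysis"
    "HOL-Computational_Algebra.Computational_Algebra"
begin

text \<open>
  A rational function is represented by its total version \<open>complex \<Rightarrow> complex\<close>. Since the fraction is
  in lowest terms, all removable singularities are removed, and the conventional value
  of \<open>poly p z / 0\<close> occurs exactly at the poles.
\<close>

definition rational_function :: "(complex \<Rightarrow> complex) \<Rightarrow> bool" where
  "rational_function R \<longleftrightarrow>
     (\<exists>p q :: complex poly. q \<noteq> 0 \<and> coprime p q \<and> R = (\<lambda>z. poly p z / poly q z))"

definition finite_poles :: "(complex \<Rightarrow> complex) \<Rightarrow> complex set" where
  "finite_poles R = {z. is_pole R z}"

text \<open>\<open>deriv R\<close> has an unspecified value at a pole of \<open>R\<close>, so poles are excluded explicitly.\<close>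

definition finite_critical_points :: "(complex \<Rightarrow> complex) \<Rightarrow> complex set" where
  "finite_critical_points R = {z. \<not> is_pole R z \<and> deriv R z = 0}"

definition pole_of_order :: "(complex \<Rightarrow> complex) \<Rightarrow> complex \<Rightarrow> int \<Rightarrow> bool" where
  "pole_of_order f z k \<longleftrightarrow> is_pole f z \<and> zorder f z = - k"

definition pole_of_order_at_infinity :: "(complex \<Rightarrow> complex) \<Rightarrow> int \<Rightarrow> bool" where
  "pole_of_order_at_infinity f k \<longleftrightarrow> pole_of_order (\<lambda>w. f (1 / w)) 0 k"

text \<open>
  The class \<open>CR m n X\<close> is meant for sets \<open>X\<close> of exactly \<open>n\<close> real points. The order of the pole at
  infinity is computed in the integers, to avoid truncated subtraction.
\<close>

definition CR :: "nat \<Rightarrow> nat \<Rightarrow> real set \<Rightarrow> (complex \<Rightarrow> complex) set" where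
  "CR m n X = {R. rational_function R \<and>
     (\<forall>z. cnj (R (cnj z)) = R z) \<and>
     finite_critical_points R = complex_of_real ` X \<and>
     (\<forall>c \<in> finite_critical_points R. zorder (deriv R) c = 1) \<and>
     finite (finite_poles R) \<and> card (finite_poles R) = m \<and>
     (\<forall>p \<in> finite_poles R. pole_of_order R p 1) \<and>
     pole_of_order_at_infinity R (int n - 2 * int m + 1)}"

definition stationary_relations ::
    "nat \<Rightarrow> nat \<Rightarrow> (nat \<Rightarrow> real) \<Rightarrow> (nat \<Rightarrow> complex) \<Rightarrow> bool" where
  "stationary_relations n m x \<xi> \<longleftrightarrow>
     (\<forall>k\<in>{1..m}. - (\<Sum>j=1..n. 1 / (\<xi> k - complex_of_real (x j)))
                  + (\<Sum>l\<in>{1..m} - {k}. 2 / (\<xi> k - \<xi> l)) = 0)"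

end

theory Submission
  imports Defs "HOL-Computational_Algebra.Field_as_Ring"
begin

text \<open>
  Write \<open>P\<close> and \<open>Q\<close> for the monic polynomials with simple roots \<open>x\<close> and \<open>\<xi>\<close>. The stationary
  relation at \<open>\<xi>\<^sub>k\<close> reads \<open>P'/P = Q''/Q'\<close> there, which says that \<open>P / Q\<^sup>2\<close> has no residue at
  \<open>\<xi>\<^sub>k\<close>. If \<open>R = p / Q\<close> lies in the class, then \<open>p' Q - p Q'\<close> is a multiple of \<open>P\<close> and the
  relation follows by differentiating. Conversely, if all residues vanish then \<open>P / Q\<^sup>2\<close> has a
  rational primitive \<open>p / Q\<close>; conjugation invariance of \<open>P\<close> and \<open>Q\<close> allows averaging it with its
  conjugate, and \<open>2 m \<le> n\<close> forces \<open>deg p = n - m + 1\<close>, hence the order of the pole at infinity.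
\<close>

section \<open>Monic polynomials with prescribed simple roots\<close>

text \<open>An infinite \<open>A\<close> gives the default product 1 and \<open>card A = 0\<close>,
  so nonvanishing and the degree formula hold for every set.\<close>

definition root_poly :: "complex set \<Rightarrow> complex poly" where
  "root_poly A = (\<Prod>a\<in>A. [:-a, 1:])"

text \<open>The numerator of the derivative of \<open>p / q\<close> over the denominator q^2, hence
  the sign opposite to the usual p q' - p' q.\<close>

definition wronskian :: "complex poly \<Rightarrow> complex poly \<Rightarrow> complex poly" where
  "wronskian p q = pderiv p * q - p * pderiv q"

lemma poly_root_poly: "poly (root_poly A) z = (\<Prod>a\<in>A. z - a)"
  by (simp add: root_poly_def poly_prod)

lemma root_poly_nonzero [simp]: "root_poly A \<noteq> 0"
  by (cases "finite A") (auto simp: root_poly_def)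

lemma poly_root_poly_eq_0_iff: "finite A \<Longrightarrow> poly (root_poly A) z = 0 \<longleftrightarrow> z \<in> A"
  by (auto simp: poly_root_poly)

lemma degree_root_poly: "degree (root_poly A) = card A"
  unfolding root_poly_def by (subst degree_prod_eq_sum_degree) auto

lemma root_poly_remove:
  "finite A \<Longrightarrow> a \<in> A \<Longrightarrow> root_poly A = [:-a, 1:] * root_poly (A - {a})"
  unfolding root_poly_def by (rule prod.remove)

lemma pderiv_linear_mult:
  fixes r :: "'a :: idom poly"
  shows "pderiv ([:-a, 1:] * r) = r + [:-a, 1:] * pderiv r"
  by (simp only: pderiv_mult) (simp add: pderiv_pCons)

lemma pderiv_sum: "pderiv (\<Sum>i\<in>I. f i) = (\<Sum>i\<in>I. pderiv (f i))"
  by (induction I rule: infinite_finite_induct) (simp_all add: pderiv_add)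

lemma pderiv_root_poly_remove:
  assumes "finite A" "a \<in> A"
  shows "pderiv (root_poly A) = root_poly (A - {a}) + [:-a, 1:] * pderiv (root_poly (A - {a}))"
  by (simp only: root_poly_remove[OF assms] pderiv_linear_mult)

text \<open>The product rule in logarithmic form; it turns the sums of the stationary relations into
  ratios of polynomial values.\<close>

lemma poly_pderiv_root_poly:
  assumes "finite A" "z \<notin> A"
  shows "poly (pderiv (root_poly A)) z = poly (root_poly A) z * (\<Sum>a\<in>A. 1 / (z - a))"
  using assms
proof (induction rule: finite_induct)
  case empty
  then show ?case by (simp add: root_poly_def)
next
  case (insert a A)
  have eq: "root_poly (insert a A) = [:-a, 1:] * root_poly A"
    using insert by (simp add: root_poly_def)
  show ?case
    using insert unfolding eq pderiv_linear_mult poly_add poly_mult by (simp add: field_simps)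
qed

lemma order_root_poly:
  assumes "finite A"
  shows "order a (root_poly A) = (if a \<in> A then 1 else 0)"
proof (cases "a \<in> A")
  case True
  have "order a (root_poly A) = order a [:-a, 1:] + order a (root_poly (A - {a}))"
    unfolding root_poly_remove[OF assms True]
    by (rule order_mult) (simp del: mult_pCons_left)
  then show ?thesis
    using True assms order_power_n_n[of a 1] by (simp add: order_0I poly_root_poly_eq_0_iff)
qed (use assms in \<open>simp add: order_0I poly_root_poly_eq_0_iff\<close>)

text \<open>Complex polynomials split into linear factors, and order 1 at every root means
  square-free, so the root set determines \<open>p\<close> up to its leading coefficient.\<close>

lemma eq_smult_root_poly:
  assumes "p \<noteq> 0" "\<And>z. poly p z = 0 \<longleftrightarrow> z \<in> A" "\<And>z. z \<in> A \<Longrightarrow> order z p = 1"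
  shows "p = smult (lead_coeff p) (root_poly A)"
proof -
  have "rsquarefree p"
    using assms by (auto simp: rsquarefree_def order_root)
  then have "smult (lead_coeff p) (\<Prod>z | poly p z = 0. [:-z, 1:]) = p"
    by (rule complex_poly_decompose_rsquarefree)
  then show ?thesis
    using assms(2) by (simp add: root_poly_def)
qed

text \<open>Both sums are logarithmic derivatives at \<open>a\<close>; multiplying by the nonzero
  values of the two polynomials clears the denominators. For Q = (z - a) Q_a one has Q'(a) = Q_a(a)
  and Q''(a) = 2 Q_a'(a), so the cofactor Q_a replaces second derivatives of Q.\<close>

lemma stationary_at_iff:
  assumes "finite X" "finite A" "a \<in> A" "a \<notin> X"
  shows "- (\<Sum>b\<in>X. 1 / (a - b)) + (\<Sum>l\<in>A - {a}. 2 / (a - l)) = 0 \<longleftrightarrow>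
    poly (pderiv (root_poly X)) a * poly (root_poly (A - {a})) a =
    2 * poly (root_poly X) a * poly (pderiv (root_poly (A - {a}))) a"
proof -
  define P Q where "P = poly (root_poly X) a" and "Q = poly (root_poly (A - {a})) a"
  have nz: "P \<noteq> 0" "Q \<noteq> 0"
    using assms by (auto simp: P_def Q_def poly_root_poly_eq_0_iff)
  have two: "(\<Sum>l\<in>A - {a}. 2 / (a - l)) = 2 * (\<Sum>l\<in>A - {a}. 1 / (a - l))"
    by (simp add: sum_distrib_left)
  have P': "poly (pderiv (root_poly X)) a = P * (\<Sum>b\<in>X. 1 / (a - b))"
    and Q': "poly (pderiv (root_poly (A - {a}))) a = Q * (\<Sum>l\<in>A - {a}. 1 / (a - l))"
    unfolding P_def Q_def using assms by (intro poly_pderiv_root_poly; simp)+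
  have "P * s * Q = 2 * P * (Q * t) \<longleftrightarrow> - s + 2 * t = 0" for s t
    using nz by (auto simp: algebra_simps)
  then show ?thesis
    unfolding two P' Q' by (simp add: P_def Q_def)
qed

section \<open>Algebra of the Wronskian\<close>

lemma wronskian_smult_right: "wronskian p (smult c q) = smult c (wronskian p q)"
  by (simp add: wronskian_def pderiv_smult smult_diff_right)

lemma wronskian_smult_left: "wronskian (smult c p) q = smult c (wronskian p q)"
  by (simp add: wronskian_def pderiv_smult smult_diff_right)

lemma wronskian_add_left: "wronskian (p + r) q = wronskian p q + wronskian r q"
  by (simp add: wronskian_def pderiv_add algebra_simps)

lemma wronskian_self [simp]: "wronskian p p = 0"
  by (simp add: wronskian_def)

text \<open>The quotient of \<open>q * t\<close> by \<open>q\<close> is \<open>t\<close>; this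
  accounts for the polynomial part of a primitive.\<close>

lemma wronskian_mult_right: "wronskian (q * t) q = q\<^sup>2 * pderiv t"
  by (simp add: wronskian_def pderiv_mult power2_eq_square algebra_simps)

lemma wronskian_sum_left: "wronskian (\<Sum>i\<in>I. f i) q = (\<Sum>i\<in>I. wronskian (f i) q)"
  by (induction I rule: infinite_finite_induct)
    (simp_all add: wronskian_add_left, simp_all add: wronskian_def)

text \<open>The quotient of the two polynomials is 1/(z - a), with derivative -1/(z - a)^2; this
  accounts for the polar part of a primitive.\<close>

lemma wronskian_root_poly_remove:
  assumes "finite A" "a \<in> A"
  shows "wronskian (root_poly (A - {a})) (root_poly A) = - (root_poly (A - {a}))\<^sup>2"
  unfolding wronskian_def pderiv_root_poly_remove[OF assms]
  unfolding root_poly_remove[OF assms]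
  by (simp only: power2_eq_square algebra_simps) simp

text \<open>At a root of \<open>q\<close> the derivative \<open>p'' q - p q''\<close> of \<open>p' q - p q'\<close> reduces to \<open>- p q''\<close>.\<close>

lemma wronskian_at_root:
  assumes "finite A" "a \<in> A" and W: "wronskian p (root_poly A) = w"
  shows "poly (pderiv w) a * poly (root_poly (A - {a})) a =
    2 * poly w a * poly (pderiv (root_poly (A - {a}))) a"
  unfolding W[symmetric] wronskian_def pderiv_root_poly_remove[OF assms(1,2)]
  unfolding root_poly_remove[OF assms(1,2)]
  by (simp add: pderiv_mult pderiv_add pderiv_diff pderiv_linear_mult pderiv_pCons algebra_simps
      del: mult_pCons_left)

section \<open>Rational primitives by partial fractions\<close>

lemma ex_pderiv_eq: "\<exists>t. pderiv t = (s :: complex poly)"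
proof
  show "pderiv (\<Sum>i\<le>degree s. monom (coeff s i / of_nat (Suc i)) (Suc i)) = s"
    by (subst (2) poly_as_sum_of_monoms[symmetric])
      (simp add: pderiv_sum pderiv_monom del: of_nat_Suc)
qed

lemma square_dvdI:
  fixes p :: "complex poly"
  assumes "poly p a = 0" "poly (pderiv p) a = 0"
  shows "[:-a, 1:]\<^sup>2 dvd p"
proof -
  obtain r where r: "p = [:-a, 1:] * r"
    using assms(1) by (auto simp: poly_eq_0_iff_dvd)
  have "poly r a = 0"
    using assms(2) unfolding r pderiv_linear_mult by simp
  then show ?thesis
    unfolding r power2_eq_square poly_eq_0_iff_dvd by (intro mult_dvd_mono) simp
qed

lemma coprime_root_poly:
  assumes "\<And>a. a \<in> A \<Longrightarrow> poly p a \<noteq> 0"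
  shows "coprime p (root_poly A)"
  unfolding root_poly_def
proof (rule prod_coprime_right)
  fix a assume "a \<in> A"
  have "prime_elem [:-a, 1:]"
    by (rule prime_elem_linear_field_poly) simp
  moreover have "\<not> [:-a, 1:] dvd p"
    using assms[OF \<open>a \<in> A\<close>] by (simp add: poly_eq_0_iff_dvd)
  ultimately show "coprime p [:-a, 1:]"
    using prime_elem_imp_coprime coprime_commute by blast
qed

text \<open>Squares of linear factors at distinct points are coprime, so the divisibilities
  multiply.\<close>

lemma root_poly_square_dvdI:
  assumes "finite A" "\<And>a. a \<in> A \<Longrightarrow> [:-a, 1:]\<^sup>2 dvd p"
  shows "(root_poly A)\<^sup>2 dvd p"
  using assms
proof (induction rule: finite_induct)
  case empty
  then show ?case by (simp add: root_poly_def)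
next
  case (insert a A)
  have eq: "root_poly (insert a A) = [:-a, 1:] * root_poly A"
    using insert by (simp add: root_poly_def)
  have "coprime ([:-a, 1:]\<^sup>2) ((root_poly A)\<^sup>2)"
    using insert(2) by (intro coprime_power_left_iff[THEN iffD2] coprime_power_right_iff[THEN iffD2]
        disjI1 coprime_root_poly) auto
  then show ?case
    unfolding eq power_mult_distrib using insert by (intro divides_mult) auto
qed

text \<open>The hypothesis says that \<open>w / Q\<^sup>2\<close> has no residues, so it has a rational primitive, read
  off from the partial fraction decomposition.\<close>

lemma ex_wronskian_eq:
  assumes "finite A"
    and "\<And>a. a \<in> A \<Longrightarrow> poly (pderiv w) a * poly (root_poly (A - {a})) a =
      2 * poly w a * poly (pderiv (root_poly (A - {a}))) a"
  shows "\<exists>p. wronskian p (root_poly A) = w"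
proof -
  define Q where "Q = (\<lambda>a. root_poly (A - {a}))"
  \<comment> \<open>The coefficient of 1/(z - a)^2 in the partial fractions of w/Q^2. Subtracting
    these terms leaves \<open>D\<close>, whose quotient by Q^2 turns out to be a polynomial.\<close>
  define c where "c = (\<lambda>a. poly w a / (poly (Q a) a)\<^sup>2)"
  define D where "D = w - (\<Sum>a\<in>A. smult (c a) ((Q a)\<^sup>2))"
  have Qa: "poly (Q a) a \<noteq> 0" for a
    using assms(1) by (simp add: Q_def poly_root_poly_eq_0_iff)
  have Qb: "poly (Q b) a = 0" if "a \<in> A" "b \<noteq> a" for a b
    using assms(1) that by (simp add: Q_def poly_root_poly_eq_0_iff)
  \<comment> \<open>For \<open>b \<noteq> a\<close> the square of \<open>Q b\<close> vanishes doubly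
    at \<open>a\<close>, so only the term with \<open>b = a\<close> contributes to the value and the
    derivative there.\<close>
  have "[:-a, 1:]\<^sup>2 dvd D" if a: "a \<in> A" for a
  proof (rule square_dvdI)
    have "poly (\<Sum>b\<in>A. smult (c b) ((Q b)\<^sup>2)) a = (\<Sum>b\<in>A. if b = a then poly w a else 0)"
      unfolding poly_sum using Qa Qb[OF a] by (intro sum.cong) (auto simp: c_def)
    then show "poly D a = 0"
      using assms(1) a by (simp add: D_def)
    have "poly (pderiv (\<Sum>b\<in>A. smult (c b) ((Q b)\<^sup>2))) a =
        (\<Sum>b\<in>A. if b = a then poly (pderiv w) a else 0)"
      unfolding pderiv_sum poly_sum
    proof (intro sum.cong refl)
      \<comment> \<open>For \<open>b = a\<close> the derivative is 2 w(a) Q_a'(a) / Q_a(a), which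
        the hypothesis on residues turns into w'(a).\<close>
      fix b assume "b \<in> A"
      have "poly (pderiv w) a * poly (Q a) a = 2 * poly w a * poly (pderiv (Q a)) a"
        using assms(2)[OF a] by (simp add: Q_def)
      then show "poly (pderiv (smult (c b) ((Q b)\<^sup>2))) a = (if b = a then poly (pderiv w) a else 0)"
        using Qa[of a] Qb[OF a, of b]
        by (auto simp: c_def pderiv_smult power2_eq_square pderiv_mult field_simps)
    qed
    then show "poly (pderiv D) a = 0"
      using assms(1) a by (simp add: D_def pderiv_diff)
  qed
  then have "(root_poly A)\<^sup>2 dvd D"
    using assms(1) by (intro root_poly_square_dvdI)
  then obtain s where s: "D = (root_poly A)\<^sup>2 * s" ..
  obtain t where t: "pderiv t = s"
    using ex_pderiv_eq by blast
  \<comment> \<open>The primitive of w/Q^2 is t plus the sum of the terms -c_a/(z - a); multiplied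
    by Q it gives this numerator.\<close>
  have "wronskian (root_poly A * t + (\<Sum>a\<in>A. smult (- c a) (Q a))) (root_poly A) =
      D + (\<Sum>a\<in>A. smult (c a) ((Q a)\<^sup>2))"
    using assms(1)
    by (simp add: wronskian_add_left wronskian_mult_right wronskian_sum_left wronskian_smult_left
        wronskian_root_poly_remove t s Q_def del: smult_minus_left) simp
  then show ?thesis
    unfolding D_def by auto
qed

section \<open>Conjugation of coefficients\<close>

lemma pderiv_map_poly_cnj: "pderiv (map_poly cnj p) = map_poly cnj (pderiv p)"
  by (rule poly_eqI) (simp add: coeff_pderiv coeff_map_poly)

lemma map_poly_cnj_mult: "map_poly cnj (p * q) = map_poly cnj p * map_poly cnj q"
  by (simp add: poly_eq_poly_eq_iff[symmetric] fun_eq_iff)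

lemma map_poly_cnj_diff: "map_poly cnj (p - q) = map_poly cnj p - map_poly cnj q"
  by (simp add: poly_eq_poly_eq_iff[symmetric] fun_eq_iff)

lemma map_poly_cnj_wronskian:
  "map_poly cnj (wronskian p q) = wronskian (map_poly cnj p) (map_poly cnj q)"
  by (simp add: wronskian_def map_poly_cnj_diff map_poly_cnj_mult pderiv_map_poly_cnj)

lemma map_poly_cnj_root_poly:
  "map_poly cnj (root_poly A) = root_poly (cnj ` A)"
proof -
  have "poly (map_poly cnj (root_poly A)) z = poly (root_poly (cnj ` A)) z" for z
    by (simp add: poly_root_poly prod.reindex inj_on_def)
  then show ?thesis
    by (simp add: poly_eq_poly_eq_iff[symmetric] fun_eq_iff)
qed

text \<open>Conjugating the equation shows that the conjugate of \<open>p\<close> is again a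
  solution. The Wronskian is linear in its first argument, so the average of the two is a real
  solution.\<close>

lemma wronskian_real_solution:
  assumes "wronskian p q = w" "map_poly cnj q = q" "map_poly cnj w = w"
  shows "\<exists>r. wronskian r q = w \<and> map_poly cnj r = r"
proof (intro exI conjI)
  let ?r = "smult (1/2) (p + map_poly cnj p)"
  have "wronskian (map_poly cnj p) q = w"
    using map_poly_cnj_wronskian[of p q] assms by simp
  then show "wronskian ?r q = w"
    using assms(1) by (simp add: wronskian_smult_left wronskian_add_left poly_eq_iff)
  show "map_poly cnj ?r = ?r"
    by (simp add: poly_eq_poly_eq_iff[symmetric] fun_eq_iff)
qed

section \<open>Degree of the Wronskian\<close>

lemma degree_wronskian_less:
  assumes "degree p < degree q"
  shows "degree (wronskian p q) \<le> 2 * degree q - 2"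
proof -
  have "degree (pderiv p * q) \<le> 2 * degree q - 2" if "degree p > 0"
    using degree_mult_le[of "pderiv p" q] that assms by (simp add: degree_pderiv)
  \<comment> \<open>For constant \<open>p\<close> the difference \<open>degree p - 1\<close>
    truncates to 0 and the degree count above fails; here the product vanishes instead.\<close>
  moreover have "pderiv p = 0" if "degree p = 0"
    using that by (simp add: pderiv_eq_0_iff)
  ultimately have "degree (pderiv p * q) \<le> 2 * degree q - 2"
    by (cases "degree p = 0") auto
  moreover have "degree (p * pderiv q) \<le> 2 * degree q - 2"
    using degree_mult_le[of p "pderiv q"] assms by (simp add: degree_pderiv)
  ultimately show ?thesis
    unfolding wronskian_def by (rule degree_diff_le)
qed

text \<open>The coefficient in the expected top degree is the product of both leading coefficients
  with the difference of the degrees, so it cannot cancel.\<close>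

lemma degree_wronskian:
  assumes "degree p > degree q" "q \<noteq> 0"
  shows "wronskian p q \<noteq> 0" "degree (wronskian p q) = degree p + degree q - 1"
proof -
  have p: "p \<noteq> 0" using assms by auto
  let ?d = "degree p + degree q - 1"
  have 1: "degree (pderiv p * q) \<le> ?d"
    using degree_mult_le[of "pderiv p" q] assms by (simp add: degree_pderiv)
  have 2: "degree (p * pderiv q) \<le> ?d"
  proof (cases "degree q = 0")
    case True
    then have "pderiv q = 0" by (simp add: pderiv_eq_0_iff)
    then show ?thesis by simp
  next
    case False
    then show ?thesis
      using degree_mult_le[of p "pderiv q"] by (simp add: degree_pderiv)
  qed
  have le: "degree (wronskian p q) \<le> ?d"
    unfolding wronskian_def using 1 2 by (rule degree_diff_le)
  have c1: "coeff (pderiv p * q) ?d = of_nat (degree p) * lead_coeff p * lead_coeff q"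
    using coeff_mult_degree_sum[of "pderiv p" q] assms by (simp add: degree_pderiv coeff_pderiv)
  have c2: "coeff (p * pderiv q) ?d = of_nat (degree q) * lead_coeff p * lead_coeff q"
  proof (cases "degree q = 0")
    case True
    then have "pderiv q = 0" by (simp add: pderiv_eq_0_iff)
    then show ?thesis using True by simp
  next
    case False
    then show ?thesis
      using coeff_mult_degree_sum[of p "pderiv q"] by (simp add: degree_pderiv coeff_pderiv)
  qed
  have "coeff (wronskian p q) ?d = (of_nat (degree p) - of_nat (degree q)) * lead_coeff p * lead_coeff q"
    unfolding wronskian_def coeff_diff c1 c2 by (simp add: algebra_simps)
  then have nz: "coeff (wronskian p q) ?d \<noteq> 0"
    using assms p by simp
  then show "wronskian p q \<noteq> 0" by auto
  show "degree (wronskian p q) = ?d"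
    using le le_degree[OF nz] by simp
qed

text \<open>Adding a multiple of \<open>q\<close> to \<open>p\<close> keeps the Wronskian. If
  \<open>p\<close> had degree at most that of \<open>q\<close>, such a change would bring its degree
  strictly below, and the Wronskian would have degree at most
  \<open>2 * degree q - 2\<close>.\<close>

lemma degree_of_wronskian:
  assumes "degree q > 0" "degree (wronskian p q) \<ge> 2 * degree q - 1"
  shows "degree p > degree q \<and> degree p + degree q = degree (wronskian p q) + 1"
proof -
  have "degree p > degree q"
  proof (rule ccontr)
    assume le: "\<not> degree q < degree p"
    define c where "c = coeff p (degree q) / lead_coeff q"
    define r where "r = p + smult (- c) q"
    have "coeff r (degree q) = 0" "degree r \<le> degree q"
      using assms(1) le by (auto simp: r_def c_def intro!: degree_diff_le)
    then have "degree r < degree q"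
      using assms(1) by (metis eq_zero_or_degree_less degree_0)
    moreover have "wronskian r q = wronskian p q"
      by (simp add: r_def wronskian_add_left wronskian_smult_left del: smult_minus_left)
    ultimately show False
      using degree_wronskian_less[of r q] assms by simp
  qed
  then show ?thesis
    using degree_wronskian(2)[of q p] assms(1) by fastforce
qed

section \<open>Zeros and poles of quotients of polynomials\<close>

lemma rational_meromorphic: "(\<lambda>z. poly p z / poly q z) meromorphic_on A"
proof -
  have "poly p analytic_on A" for p :: "complex poly"
    by (rule analytic_on_subset[OF _ subset_UNIV])
      (auto simp: analytic_on_open intro!: holomorphic_intros)
  then show ?thesis
    by (intro meromorphic_on_divide analytic_on_imp_meromorphic_on)
qed

lemma eventually_poly_nonzero: "p \<noteq> 0 \<Longrightarrow> \<forall>\<^sub>F w in at z. poly p w \<noteq> (0::complex)"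
proof -
  assume "p \<noteq> 0"
  then have "finite {w. poly p w = 0}" by (rule poly_roots_finite)
  then have "\<not> z islimpt {w. poly p w = 0}" by (rule islimpt_finite)
  then have "\<forall>\<^sub>F w in at z. w \<notin> {w. poly p w = 0}"
    unfolding islimpt_iff_eventually by simp
  then show ?thesis by simp
qed

text \<open>Splitting off the powers of the linear factor leaves a quotient that is holomorphic and
  nonzero at \<open>z\<close>. Common factors are allowed, because the quotients arising at infinity
  and from derivatives need not be in lowest terms.\<close>

lemma zorder_poly_quotient:
  fixes p q :: "complex poly"
  assumes "p \<noteq> 0" "q \<noteq> 0"
  shows "zorder (\<lambda>z. poly p z / poly q z) z = int (order z p) - int (order z q)"
proof -
  obtain u where u: "p = [:-z, 1:] ^ order z p * u" "\<not> [:-z, 1:] dvd u"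
    using order_decomp[OF assms(1)] by blast
  obtain v where v: "q = [:-z, 1:] ^ order z q * v" "\<not> [:-z, 1:] dvd v"
    using order_decomp[OF assms(2)] by blast
  let ?S = "{w. poly v w \<noteq> 0}"
  show ?thesis
  proof (rule zorder_eqI)
    show "open ?S" by (intro open_Collect_neq continuous_intros)
    show "z \<in> ?S" "poly u z / poly v z \<noteq> 0"
      using u(2) v(2) by (auto simp: poly_eq_0_iff_dvd)
    show "(\<lambda>w. poly u w / poly v w) holomorphic_on ?S"
      by (intro holomorphic_intros) auto
    fix w assume "w \<noteq> z"
    have "poly p w = (w - z) ^ order z p * poly u w" "poly q w = (w - z) ^ order z q * poly v w"
      by (subst u(1) v(1); simp)+
    then show "poly p w / poly q w =
        poly u w / poly v w * (w - z) powi (int (order z p) - int (order z q))"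
      using \<open>w \<noteq> z\<close> by (simp add: power_int_diff mult.commute)
  qed
qed

lemma is_pole_poly_quotient_iff:
  fixes p q :: "complex poly"
  assumes "p \<noteq> 0" "q \<noteq> 0"
  shows "is_pole (\<lambda>z. poly p z / poly q z) z \<longleftrightarrow> order z p < order z q"
proof
  assume "is_pole (\<lambda>z. poly p z / poly q z) z"
  then have "zorder (\<lambda>z. poly p z / poly q z) z < 0"
    using isolated_pole_imp_neg_zorder rational_meromorphic meromorphic_at_iff by blast
  then show "order z p < order z q"
    by (simp add: zorder_poly_quotient assms)
next
  assume "order z p < order z q"
  \<comment> \<open>A negative \<open>zorder\<close> indicates a pole only for a function that does
    not vanish identically near \<open>z\<close>.\<close>
  moreover have "\<forall>\<^sub>F w in at z. poly p w / poly q w \<noteq> 0"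
    using eventually_poly_nonzero[OF assms(1), of z] eventually_poly_nonzero[OF assms(2), of z]
    by eventually_elim simp
  ultimately show "is_pole (\<lambda>z. poly p z / poly q z) z"
    by (intro zorder_neg_imp_is_pole rational_meromorphic) (simp_all add: zorder_poly_quotient assms)
qed

text \<open>Substituting 1/w and clearing negative powers gives \<open>p' / q'\<close>. Reflected
  polynomials have nonzero constant term, so the orders of \<open>p'\<close> and \<open>q'\<close>
  at 0 are the degrees of \<open>q\<close> and \<open>p\<close>.\<close>

lemma pole_of_order_at_infinity_poly_quotient_iff:
  fixes p q :: "complex poly"
  assumes "p \<noteq> 0" "q \<noteq> 0"
  shows "pole_of_order_at_infinity (\<lambda>z. poly p z / poly q z) k \<longleftrightarrow>
    k > 0 \<and> int (degree p) - int (degree q) = k"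
proof -
  define p' q' where "p' = monom 1 (degree q) * reflect_poly p"
    and "q' = monom 1 (degree p) * reflect_poly q"
  have nz: "p' \<noteq> 0" "q' \<noteq> 0"
    using assms by (auto simp: p'_def q'_def)
  have "poly p (1 / w) / poly q (1 / w) = poly p' w / poly q' w" if "w \<noteq> 0" for w
    using that by (simp add: p'_def q'_def poly_reflect_poly_nz poly_monom inverse_eq_divide)
  then have ev: "\<forall>\<^sub>F w in at 0. poly p (1 / w) / poly q (1 / w) = poly p' w / poly q' w"
    by (simp add: eventually_at_filter)
  have ord: "order 0 p' = degree q" "order 0 q' = degree p"
    using nz assms by (auto simp: p'_def q'_def order_mult order_0_monom order_0I)
  show ?thesis
    unfolding pole_of_order_at_infinity_def pole_of_order_def
      is_pole_cong[OF ev refl] zorder_cong[OF ev refl]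
    using nz by (auto simp: is_pole_poly_quotient_iff zorder_poly_quotient ord)
qed

lemma deriv_poly_quotient:
  assumes "poly q z \<noteq> 0"
  shows "deriv (\<lambda>z. poly p z / poly q z) z = poly (wronskian p q) z / (poly q z)\<^sup>2"
  by (rule DERIV_imp_deriv)
    (use assms in \<open>auto intro!: derivative_eq_intros simp: wronskian_def power2_eq_square\<close>)

lemma zorder_deriv_poly_quotient:
  assumes "poly q z \<noteq> 0" "wronskian p q \<noteq> 0"
  shows "zorder (deriv (\<lambda>z. poly p z / poly q z)) z = int (order z (wronskian p q))"
proof -
  have q: "q \<noteq> 0" using assms by auto
  \<comment> \<open>The derivative formula holds off the roots of \<open>q\<close>; a punctured
    neighbourhood of \<open>z\<close> is all that \<open>zorder\<close> sees.\<close>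
  have "\<forall>\<^sub>F w in at z. deriv (\<lambda>z. poly p z / poly q z) w = poly (wronskian p q) w / poly (q\<^sup>2) w"
    using eventually_poly_nonzero[OF q, of z] by eventually_elim (simp add: deriv_poly_quotient)
  then have "zorder (deriv (\<lambda>z. poly p z / poly q z)) z =
      zorder (\<lambda>w. poly (wronskian p q) w / poly (q\<^sup>2) w) z"
    by (rule zorder_cong) simp
  also have "\<dots> = int (order z (wronskian p q)) - int (order z (q\<^sup>2))"
    using q assms by (intro zorder_poly_quotient) auto
  also have "order z (q\<^sup>2) = 0"
    using assms by (intro order_0I) simp
  finally show ?thesis by simp
qed

section \<open>The class \<open>CR\<close> and the Wronskian equation\<close>

text \<open>In lowest terms the denominator has simple roots exactly at the poles, and the Wronskian
  has simple roots exactly at the critical points; \<open>c\<close> absorbs the leading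
  coefficients.\<close>

lemma CR_imp_wronskian:
  assumes R: "R \<in> CR m n X" and A: "finite_poles R = A"
  shows "\<exists>p c. c \<noteq> 0 \<and>
    wronskian p (root_poly A) = smult c (root_poly (complex_of_real ` X))"
proof -
  let ?X = "complex_of_real ` X"
  obtain p q where pq: "q \<noteq> 0" "coprime p q" and R_eq: "R = (\<lambda>z. poly p z / poly q z)"
    using R by (auto simp: CR_def rational_function_def)
  have crit: "finite_critical_points R = ?X" "\<And>z. z \<in> ?X \<Longrightarrow> zorder (deriv R) z = 1"
    and pole: "\<And>z. z \<in> A \<Longrightarrow> pole_of_order R z 1"
    and inf: "pole_of_order_at_infinity R (int n - 2 * int m + 1)"
    using R A by (auto simp: CR_def)
  have p: "p \<noteq> 0"
    using inf by (auto simp: R_eq pole_of_order_at_infinity_def pole_of_order_def)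
  have deg: "degree p > degree q"
    using inf p pq by (simp add: R_eq pole_of_order_at_infinity_poly_quotient_iff)
  have not_both: "poly p z \<noteq> 0 \<or> poly q z \<noteq> 0" for z
    using coprime_poly_0[OF pq(2)] by blast
  have A_iff: "z \<in> A \<longleftrightarrow> poly q z = 0" for z
    using not_both[of z] p pq order_root[of p z] order_root[of q z] unfolding A[symmetric]
    by (auto simp: finite_poles_def R_eq is_pole_poly_quotient_iff)
  have ord: "order z q = 1" if "z \<in> A" for z
    using pole[OF that] that not_both[of z] p pq order_root[of p z]
    by (auto simp: A_iff R_eq pole_of_order_def zorder_poly_quotient)
  have q: "q = smult (lead_coeff q) (root_poly A)"
    using pq A_iff ord by (intro eq_smult_root_poly) auto
  have "rsquarefree q"
    using pq A_iff ord by (auto simp: rsquarefree_def order_root)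
  define w where "w = wronskian p q"
  have w: "w \<noteq> 0"
    using degree_wronskian(1)[OF deg pq(1)] by (simp add: w_def)
  \<comment> \<open>At a pole the Wronskian reduces to -p q', where p is nonzero by coprimality and
    q' because the root is simple. Hence no root of \<open>w\<close> is hidden at a pole.\<close>
  have w_A: "poly w z \<noteq> 0" if "z \<in> A" for z
  proof -
    have "poly q z = 0" using that A_iff by simp
    then have "poly (pderiv q) z \<noteq> 0"
      using \<open>rsquarefree q\<close> rsquarefree_roots by blast
    then show ?thesis
      using not_both[of z] \<open>poly q z = 0\<close> by (simp add: w_def wronskian_def)
  qed
  have crit_iff: "z \<in> ?X \<longleftrightarrow> poly w z = 0" for z
  proof (cases "z \<in> A")
    case True
    then show ?thesis
      using w_A[OF True] crit(1) A by (auto simp: finite_critical_points_def finite_poles_def)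
  next
    case False
    then have "\<not> is_pole R z" "deriv R z = poly w z / (poly q z)\<^sup>2" "poly q z \<noteq> 0"
      using A A_iff by (auto simp: finite_poles_def R_eq w_def deriv_poly_quotient)
    then show ?thesis
      unfolding crit(1)[symmetric] by (auto simp: finite_critical_points_def)
  qed
  have "order z w = 1" if z: "z \<in> ?X" for z
  proof -
    have "poly q z \<noteq> 0"
      using w_A z crit_iff A_iff by blast
    then show ?thesis
      using crit(2)[OF z] w by (simp add: R_eq w_def zorder_deriv_poly_quotient)
  qed
  then have w_eq: "w = smult (lead_coeff w) (root_poly ?X)"
    using w crit_iff by (intro eq_smult_root_poly) auto
  have "w = smult (lead_coeff q) (wronskian p (root_poly A))"
    unfolding w_def by (subst q) (rule wronskian_smult_right)
  then have "smult (inverse (lead_coeff q)) w = wronskian p (root_poly A)"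
    using pq(1) by simp
  then have "wronskian p (root_poly A) =
      smult (inverse (lead_coeff q) * lead_coeff w) (root_poly ?X)"
    by (subst (asm) w_eq) simp
  moreover have "inverse (lead_coeff q) * lead_coeff w \<noteq> 0"
    using w pq(1) by simp
  ultimately show "\<exists>p c. c \<noteq> 0 \<and> wronskian p (root_poly A) = smult c (root_poly ?X)"
    by blast
qed

text \<open>By the symmetry of \<open>R\<close>, its behaviour at \<open>cnj z\<close> is the
  conjugate of that at \<open>z\<close>, and conjugation preserves absolute values.\<close>

lemma CR_finite_poles_cnj:
  assumes "R \<in> CR m n X" "z \<in> finite_poles R"
  shows "cnj z \<in> finite_poles R"
proof -
  have real: "R w = cnj (R (cnj w))" for w
    using assms(1) by (auto simp: CR_def)
  have "LIM w at z. R w :> at_infinity"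
    using assms(2) by (simp add: finite_poles_def is_pole_def)
  moreover have "LIM w at (cnj z). cnj w :> at z"
  proof -
    have "cnj w \<noteq> z" if "w \<noteq> cnj z" for w
      using that by auto
    then show ?thesis
      by (auto simp: filterlim_at eventually_at_filter intro!: tendsto_eq_intros always_eventually)
  qed
  ultimately have "LIM w at (cnj z). R (cnj w) :> at_infinity"
    by (rule filterlim_compose)
  then have "LIM w at (cnj z). R w :> at_infinity"
    by (subst real) (simp add: filterlim_at_infinity_conv_norm_at_top)
  then show ?thesis
    by (simp add: finite_poles_def is_pole_def)
qed

lemma wronskian_imp_CR:
  assumes A: "finite A" "A \<noteq> {}" "2 * card A \<le> card X" and X: "finite X"
    and cnj: "map_poly cnj (root_poly A) = root_poly A"
    and disj: "A \<inter> complex_of_real ` X = {}"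
    and p: "wronskian p (root_poly A) = root_poly (complex_of_real ` X)" "map_poly cnj p = p"
  defines "R \<equiv> \<lambda>z. poly p z / poly (root_poly A) z"
  shows "R \<in> CR (card A) (card X) X" "finite_poles R = A"
    "finite_critical_points R = complex_of_real ` X"
proof -
  let ?X = "complex_of_real ` X" and ?q = "root_poly A"
  have X': "finite ?X" "card ?X = card X"
    using X by (simp_all add: card_image inj_on_subset[OF inj_of_real])
  have A0: "card A > 0" using A by auto
  \<comment> \<open>The Wronskian has degree \<open>card X\<close>, which is at least
    \<open>2 * card A\<close>; this excludes a numerator of degree at most
    \<open>card A\<close>.\<close>
  have deg: "degree p > card A" "degree p + card A = card X + 1"
    using degree_of_wronskian[of ?q p] A0 A(3) by (auto simp: p degree_root_poly X')
  then have p0: "p \<noteq> 0" by auto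
  have q_iff: "poly ?q z = 0 \<longleftrightarrow> z \<in> A" for z
    using A(1) by (rule poly_root_poly_eq_0_iff)
  \<comment> \<open>A common root of numerator and denominator would be a root of the Wronskian,
    hence a critical point lying in \<open>A\<close>.\<close>
  have p_A: "poly p z \<noteq> 0" if "z \<in> A" for z
  proof
    assume "poly p z = 0"
    then have "poly (wronskian p ?q) z = 0"
      using that q_iff by (simp add: wronskian_def)
    then show False
      using that disj X' by (auto simp: p poly_root_poly_eq_0_iff)
  qed
  then have ord: "order z p = 0" if "z \<in> A" for z
    using that by (simp add: order_0I)
  have pole: "is_pole R z \<longleftrightarrow> z \<in> A" for z
    using p0 A(1) ord by (auto simp: R_def is_pole_poly_quotient_iff order_root_poly)
  then show poles: "finite_poles R = A"
    by (simp add: finite_poles_def)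
  have deriv_eq: "deriv R z = poly (root_poly ?X) z / (poly ?q z)\<^sup>2" if "z \<notin> A" for z
    using that by (simp add: R_def deriv_poly_quotient q_iff p)
  show crit: "finite_critical_points R = ?X"
  proof (rule set_eqI)
    fix z
    show "z \<in> finite_critical_points R \<longleftrightarrow> z \<in> ?X"
    proof (cases "z \<in> A")
      case True
      then have "z \<notin> ?X" using disj by blast
      then show ?thesis using True by (simp add: finite_critical_points_def pole)
    next
      case False
      then show ?thesis
        using X' by (simp add: finite_critical_points_def pole deriv_eq q_iff poly_root_poly_eq_0_iff)
    qed
  qed
  have "coprime p ?q"
    using p_A by (rule coprime_root_poly)
  then have "rational_function R"
    unfolding rational_function_def R_def by (intro exI[of _ p] exI[of _ ?q]) simp
  moreover have "cnj (R (cnj z)) = R z" for z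
    using poly_map_poly_cnj[of p z] poly_map_poly_cnj[of ?q z] by (simp add: R_def cnj p)
  moreover have "zorder (deriv R) z = 1" if "z \<in> ?X" for z
  proof -
    have "poly ?q z \<noteq> 0" using that disj q_iff by auto
    then show ?thesis
      using that X' by (simp add: R_def zorder_deriv_poly_quotient p order_root_poly)
  qed
  moreover have "pole_of_order R z 1" if "z \<in> A" for z
    using that pole p0 A(1) ord
    by (simp add: pole_of_order_def R_def zorder_poly_quotient order_root_poly)
  moreover have "pole_of_order_at_infinity R (int (card X) - 2 * int (card A) + 1)"
    using deg p0 A(3) by (simp add: R_def pole_of_order_at_infinity_poly_quotient_iff degree_root_poly)
  ultimately show "R \<in> CR (card A) (card X) X"
    using A(1) by (simp add: CR_def poles crit)
qed

section \<open>The equivalence\<close>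

text \<open>Injectivity lets sums over indices be reindexed by points, and removing the index
  \<open>k\<close> amounts to removing the point \<open>\<xi> k\<close>.\<close>

lemma stationary_relations_iff:
  assumes "inj_on x {1..n}" "inj_on \<xi> {1..m}"
  shows "stationary_relations n m x \<xi> \<longleftrightarrow>
    (\<forall>a\<in>\<xi> ` {1..m}. - (\<Sum>b\<in>complex_of_real ` x ` {1..n}. 1 / (a - b)) +
      (\<Sum>l\<in>\<xi> ` {1..m} - {a}. 2 / (a - l)) = 0)"
proof -
  have 1: "(\<Sum>b\<in>complex_of_real ` x ` {1..n}. 1 / (a - b)) =
      (\<Sum>j=1..n. 1 / (a - complex_of_real (x j)))" for a
  proof -
    have "inj_on (\<lambda>j. complex_of_real (x j)) {1..n}"
      using assms(1) unfolding inj_on_def of_real_eq_iff .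
    from sum.reindex[OF this, of "\<lambda>b. 1 / (a - b)"] show ?thesis
      unfolding image_image comp_def .
  qed
  have 2: "(\<Sum>l\<in>\<xi> ` {1..m} - {\<xi> k}. 2 / (\<xi> k - l)) = (\<Sum>l\<in>{1..m} - {k}. 2 / (\<xi> k - \<xi> l))"
    if "k \<in> {1..m}" for k
  proof -
    have "\<xi> ` {1..m} - {\<xi> k} = \<xi> ` ({1..m} - {k})"
      using inj_on_image_set_diff[OF assms(2), of "{1..m}" "{k}"] that by simp
    moreover have "inj_on \<xi> ({1..m} - {k})"
      using assms(2) by (rule inj_on_diff)
    ultimately show ?thesis
      using sum.reindex[of \<xi> "{1..m} - {k}" "\<lambda>l. 2 / (\<xi> k - l)"] by (simp only: comp_def)
  qed
  show ?thesis
    unfolding stationary_relations_def 1 ball_simps(9) by (intro ball_cong refl) (simp only: 2)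
qed

theorem theorem1p4:
  fixes n m :: nat and x :: "nat \<Rightarrow> real" and \<xi> :: "nat \<Rightarrow> complex"
  assumes "n > 0" and "m > 0" and "m \<le> n div 2"
    and "inj_on x {1..n}"
    and "inj_on \<xi> {1..m}"
    and "\<xi> ` {1..m} \<inter> complex_of_real ` x ` {1..n} = {}"
  shows "((\<forall>z \<in> \<xi> ` {1..m}. cnj z \<in> \<xi> ` {1..m}) \<and> stationary_relations n m x \<xi>)
    \<longleftrightarrow> (\<exists>R \<in> CR m n (x ` {1..n}).
          finite_poles R = \<xi> ` {1..m} \<and>
          finite_critical_points R = complex_of_real ` x ` {1..n})"
proof -
  define A X where "A = \<xi> ` {1..m}" and "X = x ` {1..n}"
  let ?X = "complex_of_real ` X"
  have fin: "finite A" "finite X" "finite ?X" and card: "card A = m" "card X = n"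
    unfolding A_def X_def using card_image[OF assms(5)] card_image[OF assms(4)] by simp_all
  have disj: "A \<inter> ?X = {}"
    using assms(6) unfolding A_def X_def .
  have "stationary_relations n m x \<xi> \<longleftrightarrow>
      (\<forall>a\<in>A. - (\<Sum>b\<in>?X. 1 / (a - b)) + (\<Sum>l\<in>A - {a}. 2 / (a - l)) = 0)"
    unfolding A_def X_def using assms(4,5) by (rule stationary_relations_iff)
  also have "\<dots> \<longleftrightarrow> (\<forall>a\<in>A. poly (pderiv (root_poly ?X)) a * poly (root_poly (A - {a})) a =
      2 * poly (root_poly ?X) a * poly (pderiv (root_poly (A - {a}))) a)"
    by (intro ball_cong refl stationary_at_iff) (use fin disj in auto)
  finally have stat: "stationary_relations n m x \<xi> \<longleftrightarrow>
    (\<forall>a\<in>A. poly (pderiv (root_poly ?X)) a * poly (root_poly (A - {a})) a =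
      2 * poly (root_poly ?X) a * poly (pderiv (root_poly (A - {a}))) a)" .
  have "((\<forall>z\<in>A. cnj z \<in> A) \<and> stationary_relations n m x \<xi>) \<longleftrightarrow>
    (\<exists>R \<in> CR m n X. finite_poles R = A \<and> finite_critical_points R = ?X)"
  proof safe
    assume cnj: "\<forall>z\<in>A. cnj z \<in> A" and "stationary_relations n m x \<xi>"
    then obtain p where p: "wronskian p (root_poly A) = root_poly ?X"
      using ex_wronskian_eq[OF fin(1), of "root_poly ?X"] stat by blast
    have "cnj ` A = A"
    proof
      show "A \<subseteq> cnj ` A" using cnj by (metis complex_cnj_cnj image_eqI subsetI)
    qed (use cnj in auto)
    then have A_real: "map_poly cnj (root_poly A) = root_poly A"
      by (simp add: map_poly_cnj_root_poly)
    have "map_poly cnj (root_poly ?X) = root_poly ?X"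
      by (simp add: map_poly_cnj_root_poly image_image)
    then obtain r where r: "wronskian r (root_poly A) = root_poly ?X" "map_poly cnj r = r"
      using wronskian_real_solution[OF p A_real] by blast
    have "A \<noteq> {}" "2 * card A \<le> card X"
      using assms(2,3) card by auto
    from wronskian_imp_CR[OF fin(1) this fin(2) A_real disj r]
    show "\<exists>R \<in> CR m n X. finite_poles R = A \<and> finite_critical_points R = ?X"
      unfolding card by blast
  next
    fix R z assume "R \<in> CR m n X" "A = finite_poles R" "z \<in> finite_poles R"
    then show "cnj z \<in> finite_poles R" by (intro CR_finite_poles_cnj)
  next
    fix R assume R: "R \<in> CR m n X" and A: "A = finite_poles R"
    obtain p c where "c \<noteq> 0" and pc: "wronskian p (root_poly A) = smult c (root_poly ?X)"
      using CR_imp_wronskian[OF R A[symmetric]] by blast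
    \<comment> \<open>The relation is homogeneous in the Wronskian, so the nonzero factor
      \<open>c\<close> cancels.\<close>
    show "stationary_relations n m x \<xi>"
      unfolding stat using wronskian_at_root[OF fin(1) _ pc] \<open>c \<noteq> 0\<close>
      by (simp add: pderiv_smult)
  qed
  then show ?thesis
    unfolding A_def X_def .
qed

end
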